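(* Let $R$ be a commutative ring with unity, let $f:M\to M'$ be an epimorphism of unitary $R$-modules, and let $A=(\mu_A,\nu_A)$ be an intuitionistic fuzzy primary submodule of $M$ which is constant on $\ker f$ (i.e. $\mu_A$ and $\nu_A$ are constant on $\ker f$). Then the image $f(A)$ is an intuitionistic fuzzy primary submodule of $M'$.
   Context: Rings are commutative with unity $1\neq 0$, modules are unitary, $\theta$ is the zero element of a module, $\mathbb{N}=\{1,2,\dots\}$, and $\bigvee,\bigwedge$ (or $\vee,\wedge$) denote supremum and infimum in $[0,1]$. An intuitionistic fuzzy subset of a non-empty set $X$ is a pair $A=(\mu_A,\nu_A)$ of functions $X\to[0,1]$ with $\mu_A(x)+\nu_A(x)\le 1$ for all $x\in X$. Intuitionistic fuzzy submodule of an $R$-module $M$: an intuitionistic fuzzy subset $A$ of $M$ with (1) $\mu_A(\theta)=1$, $\nu_A(\theta)=0$; (2) $\mu_A(x+y)\ge\mu_A(x)\wedge\mu_A(y)$ and $\nu_A(x+y)\le\nu_A(x)\vee\nu_A(y)$ for all $x,y\in M$; (3) $\mu_A(rx)\ge\mu_A(x)$ and $\nu_A(rx)\le\nu_A(x)$ for all $x\in M$, $r\in R$. Radical: for an intuitionistic fuzzy subset $A$ of $M$, $\sqrt{A}=(\sqrt{\mu_A},\sqrt{\nu_A})$ is the intuitionistic fuzzy subset of $R$ given by $\sqrt{\mu_A}(r)=\bigvee_{n\in\mathbb{N}}\bigwedge_{m\in M}\mu_A(r^n m)$ and $\sqrt{\nu_A}(r)=\bigwedge_{n\in\mathbb{N}}\bigvee_{m\in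 M}\nu_A(r^n m)$. Intuitionistic fuzzy primary submodule of $M$: an intuitionistic fuzzy submodule $A$ of $M$ such that for all $r\in R$, $m\in M$, either [$\mu_A(rm)=\mu_A(m)$ and $\nu_A(rm)=\nu_A(m)$] or [$\mu_A(rm)\le\sqrt{\mu_A}(r)$ and $\nu_A(rm)\ge\sqrt{\nu_A}(r)$]. Image: for $f:M\to M'$ and an intuitionistic fuzzy submodule $A$ of $M$, $f(A)=(f(\mu_A),f(\nu_A))$ is the intuitionistic fuzzy subset of $M'$ with $f(\mu_A)(y)=\bigvee\{\mu_A(x): x\in M, f(x)=y\}$ and $f(\nu_A)(y)=\bigwedge\{\nu_A(x): x\in M, f(x)=y\}$ if $f^{-1}(y)\ne\emptyset$, and $f(\mu_A)(y)=0$, $f(\nu_A)(y)=1$ otherwise. *)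

theory Defs
  imports Complex_Main
begin

text \<open>Modules are those of \<^theory>\<open>HOL.Modules\<close>: scalars form a \<^class>\<open>comm_ring_1\<close> type
  (so 1 and 0 differ), and the module structure is the scalar multiplication \<open>scale\<close>.\<close>

text \<open>Membership and non-membership functions; being an intuitionistic fuzzy subset is the
  predicate \<open>if_subset\<close>.\<close>
type_synonym 'a ifpair = "('a \<Rightarrow> real) \<times> ('a \<Rightarrow> real)"

abbreviation mu :: "'a ifpair \<Rightarrow> 'a \<Rightarrow> real" where "mu A \<equiv> fst A"
abbreviation nu :: "'a ifpair \<Rightarrow> 'a \<Rightarrow> real" where "nu A \<equiv> snd A"

definition if_subset :: "'a ifpair \<Rightarrow> bool" where
  "if_subset A \<longleftrightarrow>
     (\<forall>x. mu A x \<in> {0..1} \<and> nu A x \<in> {0..1} \<and> mu A x + nu A x \<le> 1)"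

definition if_submodule ::
    "('r::comm_ring_1 \<Rightarrow> 'm::ab_group_add \<Rightarrow> 'm) \<Rightarrow> 'm ifpair \<Rightarrow> bool" where
  "if_submodule scale A \<longleftrightarrow>
     if_subset A \<and>
     mu A 0 = 1 \<and> nu A 0 = 0 \<and>
     (\<forall>x y. mu A (x + y) \<ge> min (mu A x) (mu A y) \<and> nu A (x + y) \<le> max (nu A x) (nu A y)) \<and>
     (\<forall>r x. mu A (scale r x) \<ge> mu A x \<and> nu A (scale r x) \<le> nu A x)"

text \<open>All index sets below are nonempty, so for an intuitionistic fuzzy subset the real suprema and
  infima are those in the unit interval.\<close>
definition if_radical ::
    "('r::comm_ring_1 \<Rightarrow> 'm::ab_group_add \<Rightarrow> 'm) \<Rightarrow> 'm ifpair \<Rightarrow> 'r ifpair" where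
  "if_radical scale A =
     (\<lambda>r. SUP n\<in>{n::nat. n \<ge> 1}. INF m. mu A (scale (r ^ n) m),
      \<lambda>r. INF n\<in>{n::nat. n \<ge> 1}. SUP m. nu A (scale (r ^ n) m))"

definition if_primary_submodule ::
    "('r::comm_ring_1 \<Rightarrow> 'm::ab_group_add \<Rightarrow> 'm) \<Rightarrow> 'm ifpair \<Rightarrow> bool" where
  "if_primary_submodule scale A \<longleftrightarrow>
     if_submodule scale A \<and>
     (\<forall>r m. (mu A (scale r m) = mu A m \<and> nu A (scale r m) = nu A m) \<or>
            (mu A (scale r m) \<le> mu (if_radical scale A) r \<and>
             nu A (scale r m) \<ge> nu (if_radical scale A) r))"

definition if_image :: "('a \<Rightarrow> 'b) \<Rightarrow> 'a ifpair \<Rightarrow> 'b ifpair" where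
  "if_image f A =
     (\<lambda>y. if f -` {y} \<noteq> {} then SUP x\<in>f -` {y}. mu A x else 0,
      \<lambda>y. if f -` {y} \<noteq> {} then INF x\<in>f -` {y}. nu A x else 1)"

end

theory Submission
  imports Defs
begin

text \<open>
  On \<open>ker f\<close> the constant values of \<open>\<mu>\<close> and \<open>\<nu>\<close> are those at the zero element, namely 1 and 0,
  the extreme values of the unit interval. Adding an element of \<open>ker f\<close> therefore costs nothing in
  the additive submodule inequalities, and \<open>A\<close> is constant on every fibre of \<open>f\<close>. The suprema and
  infima defining the image are then taken over constant families, so that
  \<open>A\<close> is the pullback of \<open>f(A)\<close> along \<open>f\<close> (\<open>if_image_apply\<close>).

  Once \<open>A\<close> is a pullback of some \<open>B\<close> along a surjective homomorphism, every condition on \<open>B\<close> can be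
  tested on elements \<open>f x\<close>, where it becomes the same condition on \<open>A\<close>. This includes the radical:
  as \<open>m\<close> runs through \<open>M\<close>, \<open>f m\<close> runs through all of \<open>M'\<close>, so \<open>A\<close> and \<open>B\<close> have the same radical
  (\<open>if_radical_pullback\<close>).
\<close>

text \<open>Translating by \<open>k\<close> cannot lower \<open>\<mu>\<close> or raise \<open>\<nu>\<close>, because \<open>k\<close> already has the extreme values.
  The scalar \<open>- 1\<close> passes these values on to \<open>- k\<close>, and translating back gives the converse
  inequalities.\<close>
lemma if_submodule_translate:
  fixes scale :: "'r::comm_ring_1 \<Rightarrow> 'm::ab_group_add \<Rightarrow> 'm"
  assumes "module scale" and sub: "if_submodule scale A"
    and k: "mu A k = 1" "nu A k = 0"
  shows "mu A (x + k) = mu A x" and "nu A (x + k) = nu A x"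
proof -
  interpret module scale by fact
  have range: "mu A y \<le> 1" "0 \<le> nu A y" for y
    using sub by (auto simp: if_submodule_def if_subset_def)
  have add: "min (mu A y) (mu A z) \<le> mu A (y + z)" "nu A (y + z) \<le> max (nu A y) (nu A z)" for y z
    using sub by (auto simp: if_submodule_def)
  have "mu A k \<le> mu A (scale (- 1) k)" "nu A (scale (- 1) k) \<le> nu A k"
    using sub unfolding if_submodule_def by blast+
  then have k': "mu A (- k) = 1" "nu A (- k) = 0"
    using k range[of "- k"] by simp_all
  show "mu A (x + k) = mu A x"
    using add(1)[of x k] add(1)[of "x + k" "- k"] k k' range(1)[of x] range(1)[of "x + k"] by simp
  show "nu A (x + k) = nu A x"
    using add(2)[of x k] add(2)[of "x + k" "- k"] k k' range(2)[of x] range(2)[of "x + k"] by simp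
qed

lemma if_submodule_constant_on_fibres:
  assumes hom: "module_hom scale scale' f" and sub: "if_submodule scale A"
    and mu_ker: "\<And>x. f x = 0 \<Longrightarrow> mu A x = c" and nu_ker: "\<And>x. f x = 0 \<Longrightarrow> nu A x = d"
    and "f x = f y"
  shows "mu A x = mu A y" and "nu A x = nu A y"
proof -
  interpret module_hom scale scale' f by fact
  have "c = 1" "d = 0"
    using mu_ker[of 0] nu_ker[of 0] sub by (simp_all add: if_submodule_def)
  moreover have "f (x - y) = 0"
    using \<open>f x = f y\<close> by (simp add: diff)
  ultimately have "mu A (x - y) = 1" "nu A (x - y) = 0"
    using mu_ker nu_ker by blast+
  from if_submodule_translate[OF m1.module_axioms sub this, of y]
  show "mu A x = mu A y" and "nu A x = nu A y" by simp_all
qed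

lemma if_image_apply:
  assumes "\<And>y. f y = f x \<Longrightarrow> mu A y = mu A x" and "\<And>y. f y = f x \<Longrightarrow> nu A y = nu A x"
  shows "mu (if_image f A) (f x) = mu A x" and "nu (if_image f A) (f x) = nu A x"
proof -
  have "mu A ` (f -` {f x}) = (\<lambda>_. mu A x) ` (f -` {f x})"
    and "nu A ` (f -` {f x}) = (\<lambda>_. nu A x) ` (f -` {f x})"
    using assms by (blast intro: image_cong)+
  moreover have "f -` {f x} \<noteq> {}" by blast
  ultimately show "mu (if_image f A) (f x) = mu A x" and "nu (if_image f A) (f x) = nu A x"
    by (simp_all add: if_image_def)
qed

lemma if_submodule_pullback:
  assumes hom: "module_hom scale scale' f" and surj: "surj f"
    and mu_pull: "\<And>x. mu B (f x) = mu A x" and nu_pull: "\<And>x. nu B (f x) = nu A x"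
    and sub: "if_submodule scale A"
  shows "if_submodule scale' B"
proof -
  interpret module_hom scale scale' f by fact
  have bounds: "mu A x \<in> {0..1} \<and> nu A x \<in> {0..1} \<and> mu A x + nu A x \<le> 1" for x
    using sub by (auto simp: if_submodule_def if_subset_def)
  have lift: "\<exists>x. y = f x" for y
    using surj by (rule surjD)
  have "if_subset B"
    unfolding if_subset_def
  proof
    fix y
    obtain x where "y = f x" using lift by blast
    then show "mu B y \<in> {0..1} \<and> nu B y \<in> {0..1} \<and> mu B y + nu B y \<le> 1"
      using bounds[of x] by (simp add: mu_pull nu_pull)
  qed
  moreover have "mu B 0 = 1" "nu B 0 = 0"
    using mu_pull[of 0] nu_pull[of 0] sub by (simp_all add: if_submodule_def)
  moreover have "mu B (y + z) \<ge> min (mu B y) (mu B z) \<and> nu B (y + z) \<le> max (nu B y) (nu B z)"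
    for y z
  proof -
    obtain u v where "y = f u" "z = f v" using lift by blast
    then show ?thesis
      using sub by (simp add: if_submodule_def mu_pull nu_pull flip: add)
  qed
  moreover have "mu B (scale' r y) \<ge> mu B y \<and> nu B (scale' r y) \<le> nu B y" for r y
  proof -
    obtain u where "y = f u" using lift by blast
    then show ?thesis
      using sub by (simp add: if_submodule_def mu_pull nu_pull flip: scale)
  qed
  ultimately show ?thesis
    unfolding if_submodule_def by blast
qed

lemma if_radical_pullback:
  assumes hom: "module_hom scale scale' f" and surj: "surj f"
    and mu_pull: "\<And>x. mu B (f x) = mu A x" and nu_pull: "\<And>x. nu B (f x) = nu A x"
  shows "if_radical scale' B = if_radical scale A"
proof -
  interpret module_hom scale scale' f by fact
  have "range (\<lambda>m. mu B (scale' s m)) = range (\<lambda>m. mu A (scale s m))"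
    and "range (\<lambda>m. nu B (scale' s m)) = range (\<lambda>m. nu A (scale s m))" for s
  proof -
    have "range (\<lambda>m. mu B (scale' s m)) = range (\<lambda>m. mu B (scale' s (f m)))"
      and "range (\<lambda>m. nu B (scale' s m)) = range (\<lambda>m. nu B (scale' s (f m)))"
      using image_image[of "\<lambda>m. mu B (scale' s m)" f UNIV]
        image_image[of "\<lambda>m. nu B (scale' s m)" f UNIV] surj by simp_all
    then show "range (\<lambda>m. mu B (scale' s m)) = range (\<lambda>m. mu A (scale s m))"
      and "range (\<lambda>m. nu B (scale' s m)) = range (\<lambda>m. nu A (scale s m))"
      by (simp_all add: mu_pull nu_pull flip: scale)
  qed
  then show ?thesis
    by (simp add: if_radical_def)
qed

lemma if_primary_submodule_pullback:
  assumes hom: "module_hom scale scale' f" and surj: "surj f"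
    and mu_pull: "\<And>x. mu B (f x) = mu A x" and nu_pull: "\<And>x. nu B (f x) = nu A x"
    and prim: "if_primary_submodule scale A"
  shows "if_primary_submodule scale' B"
proof -
  interpret module_hom scale scale' f by fact
  have "if_submodule scale' B"
    using if_submodule_pullback[OF hom surj mu_pull nu_pull] prim
    by (simp add: if_primary_submodule_def)
  moreover have "(mu B (scale' r y) = mu B y \<and> nu B (scale' r y) = nu B y) \<or>
      (mu B (scale' r y) \<le> mu (if_radical scale' B) r \<and>
       nu B (scale' r y) \<ge> nu (if_radical scale' B) r)" for r y
  proof -
    obtain x where "y = f x" using surj by (rule surjE)
    then show ?thesis
      using prim if_radical_pullback[OF hom surj mu_pull nu_pull]
      by (simp add: if_primary_submodule_def mu_pull nu_pull flip: scale)
  qed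
  ultimately show ?thesis
    unfolding if_primary_submodule_def by blast
qed

theorem theorem3p22:
  fixes scale :: "'r::comm_ring_1 \<Rightarrow> 'm::ab_group_add \<Rightarrow> 'm"
    and scale' :: "'r \<Rightarrow> 'n::ab_group_add \<Rightarrow> 'n"
    and f :: "'m \<Rightarrow> 'n"
    and A :: "'m ifpair"
  assumes "module_hom scale scale' f" and "surj f"
    and "if_primary_submodule scale A"
    and "\<exists>c. \<forall>x. f x = 0 \<longrightarrow> mu A x = c"
    and "\<exists>d. \<forall>x. f x = 0 \<longrightarrow> nu A x = d"
  shows "if_primary_submodule scale' (if_image f A)"
proof -
  from assms(4,5) obtain c d
    where ker: "\<And>x. f x = 0 \<Longrightarrow> mu A x = c" "\<And>x. f x = 0 \<Longrightarrow> nu A x = d"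
    by blast
  have sub: "if_submodule scale A"
    using assms(3) by (simp add: if_primary_submodule_def)
  note fibres = if_submodule_constant_on_fibres[OF assms(1) sub ker]
  show ?thesis
    using if_image_apply[OF fibres] assms(1-3)
    by (intro if_primary_submodule_pullback[where A = A and f = f]) auto
qed

end
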